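(* The deterministic value-query complexity of finding an EFX allocation satisfies $$D_{\mathrm{sub}}[EFX_{id}(2,2k+1)]\in\Omega\!\left(\frac{1}{k}\binom{2k+1}{k}\right).$$ Here there are two players who share one identical submodular valuation on $2k+1$ goods. In particular, the bound holds for the general problem with arbitrary valuations.
   Context: Goods form a finite set $M$. A valuation is a function $v:2^M\to\mathbb{R}_{\ge 0}$ with $v(\emptyset)=0$ that is monotone: $v(S)\le v(T)$ whenever $S\subseteq T$. It is submodular if $v(S\cup\{x\})-v(S)\ge v(T\cup\{x\})-v(T)$ for all $S\subseteq T$ and $x\notin T$. An allocation is an ordered partition $(A_1,\dots,A_n)$ of $M$; parts may be empty. It is EFX if for all players $i,j$ and every $g\in A_j$ we have $v_i(A_i)\ge v_i(A_j\setminus\{g\})$. $D_{\mathrm{sub}}[EFX_{id}(n,m)]$ is defined as follows. All $n$ players share one valuation $v$ on $M=[m]$, restricted to be submodular. The algorithm learns about $v$ only through adaptive value queries, where querying a set $S$ returns $v(S)$, and must output an EFX allocation. The quantity is the minimum, over deterministic algorithms, of the maximum, over such $v$, of the number of queries used. *)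

theory Defs
  imports Complex_Main "HOL-Library.Extended_Nat"
begin

definition goods :: "nat \<Rightarrow> nat set" where
  "goods m = {1..m}"

definition valuation_on :: "nat set \<Rightarrow> (nat set \<Rightarrow> real) \<Rightarrow> bool" where
  "valuation_on M v \<longleftrightarrow> v {} = 0 \<and> (\<forall>S\<subseteq>M. 0 \<le> v S)
     \<and> (\<forall>S T. S \<subseteq> T \<and> T \<subseteq> M \<longrightarrow> v S \<le> v T)"

definition submodular_on :: "nat set \<Rightarrow> (nat set \<Rightarrow> real) \<Rightarrow> bool" where
  "submodular_on M v \<longleftrightarrow> (\<forall>S T x. S \<subseteq> T \<and> T \<subseteq> M \<and> x \<in> M \<and> x \<notin> T \<longrightarrow>
      v (insert x S) - v S \<ge> v (insert x T) - v T)"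

definition allocation :: "nat \<Rightarrow> nat set \<Rightarrow> nat set list \<Rightarrow> bool" where
  "allocation n M A \<longleftrightarrow> length A = n \<and> (\<Union>i<n. A ! i) = M
     \<and> (\<forall>i<n. \<forall>j<n. i \<noteq> j \<longrightarrow> A ! i \<inter> A ! j = {})"

definition EFX_id :: "nat \<Rightarrow> (nat set \<Rightarrow> real) \<Rightarrow> nat set list \<Rightarrow> bool" where
  "EFX_id n v A \<longleftrightarrow> (\<forall>i<n. \<forall>j<n. \<forall>g\<in>A ! j. v (A ! i) \<ge> v (A ! j - {g}))"

text \<open>Deterministic adaptive value-query algorithms, as decision trees: an inner node
  queries a set S and branches on the answer v(S); a leaf outputs an allocation.\<close>
datatype qtree = Leaf "nat set list" | Query "nat set" "real \<Rightarrow> qtree"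

text \<open>Running the algorithm on valuation v with ground set M.  A query of S is answered
  with v (S \<inter> M) (only subsets of M are meaningful queries).\<close>
primrec num_queries :: "nat set \<Rightarrow> (nat set \<Rightarrow> real) \<Rightarrow> qtree \<Rightarrow> nat" where
  "num_queries M v (Leaf A) = 0"
| "num_queries M v (Query S f) = Suc (num_queries M v (f (v (S \<inter> M))))"

primrec alg_output :: "nat set \<Rightarrow> (nat set \<Rightarrow> real) \<Rightarrow> qtree \<Rightarrow> nat set list" where
  "alg_output M v (Leaf A) = A"
| "alg_output M v (Query S f) = alg_output M v (f (v (S \<inter> M)))"

definition sub_valuations :: "nat \<Rightarrow> (nat set \<Rightarrow> real) set" where
  "sub_valuations m = {v. valuation_on (goods m) v \<and> submodular_on (goods m) v}"

definition solves_EFX_id_sub :: "nat \<Rightarrow> nat \<Rightarrow> qtree \<Rightarrow> bool" where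
  "solves_EFX_id_sub n m t \<longleftrightarrow> (\<forall>v\<in>sub_valuations m.
      allocation n (goods m) (alg_output (goods m) v t) \<and> EFX_id n v (alg_output (goods m) v t))"

definition D_sub_EFX_id :: "nat \<Rightarrow> nat \<Rightarrow> enat" where
  "D_sub_EFX_id n m = (INF t\<in>{t. solves_EFX_id_sub n m t}.
      SUP v\<in>sub_valuations m. enat (num_queries (goods m) v t))"

end

theory Submission
  imports Defs "HOL-Combinatorics.Permutations"
begin

text \<open>For valuations that are additive with slope 2 below size \<open>k\<close> and constant above it, EFX
  allocations of \<open>2k + 1\<close> goods are exactly the local maxima of the values on the odd graph, whose
  vertices are the \<open>k\<close>-sets and whose edges join disjoint sets. An adversary that always keeps a
  large connected set of unqueried vertices, with all values committed outside of it leading uphill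
  into it, can delay a local maximum until the queried vertices disconnect a constant fraction of
  the graph. Such a separator has \<open>\<Omega>(N / k)\<close> of the \<open>N\<close> vertices: a random permutation of the
  goods maps a fixed walk of length at most \<open>2k\<close> to a walk each vertex of which is uniformly
  distributed, and every walk between two separated sides meets the separator.\<close>

section \<open>The odd graph and its symmetries\<close>

locale odd_graph =
  fixes M :: "'a set" and k :: nat
  assumes finite_M: "finite M" and card_M: "card M = 2 * k + 1"
begin

definition V :: "'a set set" where
  "V = {X. X \<subseteq> M \<and> card X = k}"

lemma finite_V: "finite V"
  unfolding V_def using finite_M by (auto intro: finite_subset[of _ "Pow M"])

lemma card_V: "card V = (2 * k + 1) choose k"
  unfolding V_def using n_subsets[OF finite_M] card_M by simp

lemma V_nonempty: "V \<noteq> {}"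
  using card_V by (metis card.empty binomial_eq_0_iff not_less le_add1 mult_2 add.assoc)

lemma image_permutes_in_V:
  assumes "p permutes M" "A \<in> V"
  shows "p ` A \<in> V"
  using assms permutes_inj[OF assms(1)]
  by (auto simp: V_def card_image inj_on_subset permutes_in_image)

text \<open>The complements of \<open>A\<close> and \<open>B\<close> in \<open>M\<close> have equal
  size too, so a bijection between the sets and one between the complements glue to a
  permutation.\<close>

lemma transitive:
  assumes "A \<in> V" "B \<in> V"
  shows "\<exists>p. p permutes M \<and> p ` A = B"
proof -
  have sub: "A \<subseteq> M" "B \<subseteq> M" and card: "card A = card B"
    using assms by (auto simp: V_def)
  have fin: "finite A" "finite B" using sub finite_M finite_subset by auto
  obtain f where f: "bij_betw f A B"
    using finite_same_card_bij[OF fin card] by blast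
  have "card (M - A) = card (M - B)"
    using sub card fin by (simp add: card_Diff_subset)
  then obtain h where h: "bij_betw h (M - A) (M - B)"
    using finite_same_card_bij finite_M by blast
  define p where "p x = (if x \<in> A then f x else if x \<in> M then h x else x)" for x
  have pA: "bij_betw p A B"
    using f by (rule bij_betw_cong[THEN iffD1, rotated]) (simp add: p_def)
  have pD: "bij_betw p (M - A) (M - B)"
    using h by (rule bij_betw_cong[THEN iffD1, rotated]) (simp add: p_def)
  have "bij_betw p (A \<union> (M - A)) (B \<union> (M - B))"
    using pA pD by (rule bij_betw_combine) auto
  then have "bij_betw p M M" using sub by (simp add: Un_absorb1)
  then have "p permutes M"
    by (rule bij_imp_permutes) (use sub in \<open>auto simp: p_def\<close>)
  then show ?thesis using pA by (auto simp: bij_betw_def)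
qed

text \<open>Composing with permutations that carry \<open>A'\<close> to \<open>A\<close> and
  \<open>B\<close> to \<open>B'\<close> matches the two families.\<close>

lemma card_permutations_eq:
  assumes "A \<in> V" "B \<in> V" "A' \<in> V" "B' \<in> V"
  shows "card {p. p permutes M \<and> p ` A = B} = card {p. p permutes M \<and> p ` A' = B'}"
proof -
  obtain a where a: "a permutes M" "a ` A' = A" using transitive assms by blast
  obtain b where b: "b permutes M" "b ` B = B'" using transitive assms by blast
  have ia: "inv a permutes M" "inv a ` A = A'"
    using a by (auto simp: permutes_inv permutes_inverses image_comp comp_def
        intro: image_eqI simp flip: a(2))
  have ib: "inv b permutes M" "inv b ` B' = B"
    using b by (auto simp: permutes_inv permutes_inverses image_comp comp_def
        intro: image_eqI simp flip: b(2))
  have "bij_betw (\<lambda>p. b \<circ> p \<circ> a) {p. p permutes M \<and> p ` A = B} {p. p permutes M \<and> p ` A' = B'}"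
  proof (rule bij_betw_byWitness[where f' = "\<lambda>p. inv b \<circ> p \<circ> inv a"])
    show "(\<lambda>p. b \<circ> p \<circ> a) ` {p. p permutes M \<and> p ` A = B} \<subseteq> {p. p permutes M \<and> p ` A' = B'}"
      using a b by (auto simp: permutes_compose simp flip: image_comp)
    show "(\<lambda>p. inv b \<circ> p \<circ> inv a) ` {p. p permutes M \<and> p ` A' = B'} \<subseteq> {p. p permutes M \<and> p ` A = B}"
      using ia ib by (auto simp: permutes_compose simp flip: image_comp)
  qed (use a b in \<open>auto simp: fun_eq_iff permutes_inverses\<close>)
  then show ?thesis by (rule bij_betw_same_card)
qed

text \<open>This is uniform distribution in counting form. The weight \<open>w\<close> depends on
  neither \<open>A\<close> nor \<open>X\<close>, and being positive it can be cancelled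
  later.\<close>

lemma card_permutations_into:
  "\<exists>w>0. \<forall>A\<in>V. \<forall>X\<subseteq>V. card {p. p permutes M \<and> p ` A \<in> X} = w * card X"
proof -
  obtain A0 where A0: "A0 \<in> V" using V_nonempty by blast
  define w where "w = card {p. p permutes M \<and> p ` A0 = A0}"
  have fin: "finite {p. p permutes M \<and> P p}" for P
    using finite_permutations[OF finite_M] by (rule finite_subset[rotated]) auto
  have "{p. p permutes M \<and> p ` A0 = A0} \<noteq> {}" using permutes_id[of M] by fastforce
  then have "w > 0" unfolding w_def using fin[of "\<lambda>p. p ` A0 = A0"] by (simp add: card_gt_0_iff)
  moreover have "card {p. p permutes M \<and> p ` A \<in> X} = w * card X" if "A \<in> V" "X \<subseteq> V" for A X
  proof -
    have "{p. p permutes M \<and> p ` A \<in> X} = (\<Union>B\<in>X. {p. p permutes M \<and> p ` A = B})" by auto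
    also have "card \<dots> = (\<Sum>B\<in>X. card {p. p permutes M \<and> p ` A = B})"
      using fin that finite_V by (intro card_UN_disjoint) (auto intro: finite_subset)
    also have "\<dots> = (\<Sum>B\<in>X. w)"
      unfolding w_def using that A0 by (intro sum.cong card_permutations_eq) auto
    finally show ?thesis by simp
  qed
  ultimately show ?thesis by blast
qed

section \<open>Vertex separators\<close>

text \<open>\<open>U\<close> is a union of connected components of the graph that remains after
  deleting \<open>Q\<close>; edges are disjointness.\<close>

definition closed_off :: "'a set set \<Rightarrow> 'a set set \<Rightarrow> bool" where
  "closed_off Q U \<longleftrightarrow> U \<subseteq> V \<and> U \<inter> Q = {} \<and> (\<forall>x\<in>U. \<forall>y\<in>V. x \<inter> y = {} \<longrightarrow> y \<in> U \<union> Q)"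

text \<open>The sets \<open>B' = B - {b} \<union> {a}\<close> and \<open>B\<close> have the common neighbour \<open>M - B - {a}\<close>, so
  exchanging one element is a walk of length two.\<close>
lemma card_permutations_crossing:
  assumes "closed_off Q S" "Q \<subseteq> V"
    and w: "\<forall>A\<in>V. \<forall>X\<subseteq>V. card {p. p permutes M \<and> p ` A \<in> X} = w * card X"
    and "A \<in> V" "B \<in> V" "card (B - A) = n"
  shows "card {p. p permutes M \<and> p ` A \<in> S \<and> p ` B \<in> V - S - Q} \<le> n * (2 * (w * card Q))"
  using \<open>B \<in> V\<close> \<open>card (B - A) = n\<close>
proof (induction n arbitrary: B)
  case 0
  have fin: "finite A" "finite B" using 0 \<open>A \<in> V\<close> finite_M finite_subset by (auto simp: V_def)
  then have "B \<subseteq> A" using 0 by auto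
  then have "A = B" using 0 \<open>A \<in> V\<close> fin by (metis (lifting) V_def card_subset_eq mem_Collect_eq)
  then have "{p. p permutes M \<and> p ` A \<in> S \<and> p ` B \<in> V - S - Q} = {}" by auto
  then show ?case by (metis card.empty zero_le)
next
  case (Suc n)
  have A: "A \<subseteq> M" "card A = k" and B: "B \<subseteq> M" "card B = k"
    using Suc \<open>A \<in> V\<close> by (auto simp: V_def)
  have fin: "finite A" "finite B" using A B finite_M finite_subset by auto
  obtain b where b: "b \<in> B" "b \<notin> A" using Suc.prems by (metis Diff_iff card_eq_0_iff equals0I nat.simps(3))
  have "\<not> A \<subseteq> B" using A B b fin by (metis card_subset_eq)
  then obtain a where a: "a \<in> A" "a \<notin> B" by blast
  define B' where "B' = insert a (B - {b})"
  define C where "C = M - B - {a}"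
  have "B' \<in> V" using a b A B fin
    by (auto simp: V_def B'_def card_insert_if) (metis One_nat_def Suc_pred card_gt_0_iff empty_iff)
  have "C \<in> V" using a A B fin card_M finite_M
    by (auto simp: V_def C_def card_Diff_subset)
  have "B' - A = (B - A) - {b}" using a by (auto simp: B'_def)
  then have "card (B' - A) = n" using Suc.prems b by simp
  note IH = Suc.IH[OF \<open>B' \<in> V\<close> this]
  have disj: "C \<inter> B = {}" "B' \<inter> C = {}" by (auto simp: B'_def C_def)
  \<comment> \<open>Suppose the images of \<open>B'\<close> and \<open>C\<close> avoid
    \<open>Q\<close>. If that of \<open>B'\<close> lay in \<open>S\<close>, so would that of its
    neighbour \<open>C\<close>, and then that of \<open>B\<close> would lie in \<open>S\<close> or
    \<open>Q\<close>, which is excluded. So \<open>B'\<close> already lands on the far side.\<close>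
  have "{p. p permutes M \<and> p ` A \<in> S \<and> p ` B \<in> V - S - Q} \<subseteq>
    {p. p permutes M \<and> p ` A \<in> S \<and> p ` B' \<in> V - S - Q} \<union>
    ({p. p permutes M \<and> p ` B' \<in> Q} \<union> {p. p permutes M \<and> p ` C \<in> Q})" (is "?L \<subseteq> ?X \<union> (?Y \<union> ?Z)")
  proof
    fix p assume "p \<in> ?L"
    then have p: "p permutes M" "p ` A \<in> S" "p ` B \<in> V" "p ` B \<notin> S" "p ` B \<notin> Q" by auto
    have in_V: "p ` B' \<in> V" "p ` C \<in> V" using image_permutes_in_V p(1) \<open>B' \<in> V\<close> \<open>C \<in> V\<close> by auto
    have "p ` C \<inter> p ` B = {}" "p ` B' \<inter> p ` C = {}"
      using disj permutes_inj[OF p(1)] by (auto dest: injD simp flip: image_Int)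
    then have "p ` C \<in> S \<Longrightarrow> False" "p ` B' \<in> S \<Longrightarrow> p ` C \<in> S \<union> Q"
      using assms(1) p in_V unfolding closed_off_def by blast+
    then show "p \<in> ?X \<union> (?Y \<union> ?Z)" using p in_V by auto
  qed
  moreover have "finite (?X \<union> (?Y \<union> ?Z))"
    using finite_permutations[OF finite_M] by (rule finite_subset[rotated]) auto
  ultimately have "card ?L \<le> card (?X \<union> (?Y \<union> ?Z))" by (rule card_mono[rotated])
  also have "\<dots> \<le> card ?X + (card ?Y + card ?Z)"
    by (meson add_left_mono card_Un_le order_trans)
  also have "card ?Y = w * card Q" using w \<open>B' \<in> V\<close> \<open>Q \<subseteq> V\<close> by blast
  also have "card ?Z = w * card Q" using w \<open>C \<in> V\<close> \<open>Q \<subseteq> V\<close> by blast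
  finally show ?case using IH by simp
qed

text \<open>Double counting of pairs of a permutation and a vertex \<open>B\<close> such that a
  fixed \<open>A\<close> lands in \<open>S\<close> and \<open>B\<close> on the far side. Each
  permutation has as many \<open>B\<close> as the far side has vertices; each \<open>B\<close> is at
  most \<open>k\<close> exchanges away from \<open>A\<close>, which bounds its permutations.\<close>

theorem separator_bound:
  assumes "closed_off Q S" "Q \<subseteq> V"
  shows "card S * card (V - S - Q) \<le> 2 * k * card V * card Q"
proof -
  let ?T = "V - S - Q"
  have "S \<subseteq> V" using assms by (simp add: closed_off_def)
  obtain w where "w > 0"
    and w: "\<forall>A\<in>V. \<forall>X\<subseteq>V. card {p. p permutes M \<and> p ` A \<in> X} = w * card X"
    using card_permutations_into by blast
  obtain A where "A \<in> V" using V_nonempty by blast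
  let ?P = "{p. p permutes M \<and> p ` A \<in> S}"
  have "finite ?P"
    using finite_permutations[OF finite_M] by (rule finite_subset[rotated]) auto
  have "card {B \<in> V. p ` B \<in> ?T} = card ?T" if "p permutes M" for p
  proof -
    have "bij_betw (image p) {B \<in> V. p ` B \<in> ?T} ?T"
    proof (rule bij_betw_byWitness[where f' = "image (inv p)"])
      show "image (inv p) ` ?T \<subseteq> {B \<in> V. p ` B \<in> ?T}"
        using that by (auto simp: image_comp comp_def permutes_inverses
            intro!: image_permutes_in_V permutes_inv)
    qed (use that in \<open>auto simp: image_comp comp_def permutes_inverses\<close>)
    then show ?thesis by (rule bij_betw_same_card)
  qed
  then have "(\<Sum>B\<in>V. card {p \<in> ?P. p ` B \<in> ?T}) = (\<Sum>p\<in>?P. card ?T)"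
    using finite_V \<open>finite ?P\<close> by (intro sum_multicount_gen) auto
  also have "\<dots> = w * (card S * card ?T)"
    using w \<open>A \<in> V\<close> \<open>S \<subseteq> V\<close> by simp
  finally have "w * (card S * card ?T) = (\<Sum>B\<in>V. card {p \<in> ?P. p ` B \<in> ?T})" by simp
  also have "\<dots> \<le> (\<Sum>B\<in>V. k * (2 * (w * card Q)))"
  proof (rule sum_mono)
    fix B assume "B \<in> V"
    then have "card (B - A) \<le> k"
      using finite_M by (auto simp: V_def intro: card_mono dest: finite_subset)
    have "card {p \<in> ?P. p ` B \<in> ?T} \<le> card (B - A) * (2 * (w * card Q))"
      using card_permutations_crossing[OF assms w \<open>A \<in> V\<close> \<open>B \<in> V\<close> refl] by (simp add: conj_assoc)
    also have "\<dots> \<le> k * (2 * (w * card Q))" using \<open>card (B - A) \<le> k\<close> by simp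
    finally show "card {p \<in> ?P. p ` B \<in> ?T} \<le> k * (2 * (w * card Q))" .
  qed
  also have "\<dots> = w * (2 * k * card V * card Q)" by simp
  finally show ?thesis using \<open>w > 0\<close> by simp
qed

section \<open>Large connected components\<close>

text \<open>Connectedness by cuts instead of paths: a cut without edges splits a closed-off set into
  two closed-off sets, and a cut edge lets values be committed one vertex at a time.\<close>

definition unsplittable :: "'a set set \<Rightarrow> bool" where
  "unsplittable C \<longleftrightarrow> (\<forall>X\<subseteq>C. X \<noteq> {} \<and> X \<noteq> C \<longrightarrow> (\<exists>x\<in>X. \<exists>y\<in>C - X. x \<inter> y = {}))"

text \<open>Take a smallest closed-off part with more than half of the vertices. If it split, each
  piece would be closed off and have at most half of them, hence less than a quarter by the
  separator bound, too few together.\<close>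

lemma large_unsplittable_part:
  assumes "closed_off Q W" "card V < 2 * card W" "Q \<subseteq> V" "(16 * k + 2) * card Q < card V"
  shows "\<exists>U\<subseteq>W. closed_off Q U \<and> unsplittable U \<and> card V < 2 * card U"
proof -
  let ?good = "\<lambda>U. U \<subseteq> W \<and> closed_off Q U \<and> card V < 2 * card U"
  obtain U where U: "?good U" and min: "\<And>X. ?good X \<Longrightarrow> card U \<le> card X"
    using ex_has_least_nat[of ?good W card] assms by blast
  have "U \<subseteq> V" using U by (simp add: closed_off_def)
  then have finU: "finite U" using finite_V finite_subset by blast
  \<comment> \<open>Source of \<open>16 * k + 2\<close>: if \<open>X\<close> has at least a quarter
    of the vertices, the bound leaves at most \<open>8 * k * card Q\<close> beyond \<open>X\<close>
    and \<open>Q\<close>; if it has at most half, at least half of \<open>card V\<close> minus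
    \<open>card Q\<close> lie there.\<close>
  have small: "4 * card X < card V" if "closed_off Q X" "2 * card X \<le> card V" for X
  proof (rule ccontr)
    assume large: "\<not> 4 * card X < card V"
    have "X \<subseteq> V" "X \<inter> Q = {}" using that by (auto simp: closed_off_def)
    have fin: "finite X" "finite Q"
      using \<open>X \<subseteq> V\<close> \<open>Q \<subseteq> V\<close> finite_V by (auto intro: finite_subset)
    have "card (V - X - Q) = card V - card X - card Q"
      using \<open>X \<subseteq> V\<close> \<open>X \<inter> Q = {}\<close> \<open>Q \<subseteq> V\<close> fin
      by (subst card_Diff_subset, simp, blast) (simp add: card_Diff_subset)
    then have T: "card V \<le> 2 * card (V - X - Q) + 2 * card Q" using that by linarith
    have "card V * (2 * card (V - X - Q)) \<le> 4 * card X * (2 * card (V - X - Q))"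
      using large by (intro mult_right_mono) auto
    also have "\<dots> \<le> card V * (16 * k * card Q)"
      using separator_bound[OF that(1) \<open>Q \<subseteq> V\<close>] by (simp add: algebra_simps)
    finally have "2 * card (V - X - Q) \<le> 16 * k * card Q"
      using assms(4) by (metis mult_le_cancel1 gr_zeroI not_less_zero)
    then show False using T assms(4) by (simp add: algebra_simps)
  qed
  have "unsplittable U"
    unfolding unsplittable_def
  proof (intro allI impI, rule ccontr)
    fix X assume "X \<subseteq> U" and X: "X \<noteq> {} \<and> X \<noteq> U"
      and no_edge: "\<not> (\<exists>x\<in>X. \<exists>y\<in>U - X. x \<inter> y = {})"
    have no_edge': "y \<notin> U - X" if "x \<in> X" "x \<inter> y = {}" for x y
      using no_edge that by blast
    have UQ: "y \<in> U \<union> Q" if "x \<in> U" "y \<in> V" "x \<inter> y = {}" for x y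
      using U that unfolding closed_off_def by blast
    have "U \<inter> Q = {}" using U by (simp add: closed_off_def)
    have "y \<in> X \<union> Q" if "x \<in> X" "y \<in> V" "x \<inter> y = {}" for x y
      using UQ[OF _ that(2,3)] no_edge'[OF that(1,3)] that(1) \<open>X \<subseteq> U\<close> by blast
    moreover have "y \<in> (U - X) \<union> Q" if "x \<in> U - X" "y \<in> V" "x \<inter> y = {}" for x y
      using UQ[OF _ that(2,3)] no_edge'[of y x] that(1,3) by (auto simp: Int_commute)
    ultimately have closed: "closed_off Q X" "closed_off Q (U - X)"
      unfolding closed_off_def using \<open>X \<subseteq> U\<close> \<open>U \<subseteq> V\<close> \<open>U \<inter> Q = {}\<close> by blast+
    have less: "card X < card U" "card (U - X) < card U"
      using X \<open>X \<subseteq> U\<close> finU by (auto intro!: psubset_card_mono)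
    have "2 * card X \<le> card V" "2 * card (U - X) \<le> card V"
      using min[of X] min[of "U - X"] less closed U \<open>X \<subseteq> U\<close> by (auto simp flip: not_less)
    then have "4 * card X < card V" "4 * card (U - X) < card V" using small closed by auto
    moreover have "card U = card X + card (U - X)"
      using \<open>X \<subseteq> U\<close> finU by (metis card_Un_disjoint Diff_disjoint Un_Diff_cancel Un_absorb1 finite_Diff finite_subset)
    ultimately show False using U by linarith
  qed
  then show ?thesis using U by blast
qed

text \<open>Deleting \<open>s\<close> can disconnect \<open>C\<close>, but the separator bound
  leaves at most \<open>4 * k * card Q\<close> vertices outside \<open>C\<close> and
  \<open>Q\<close>, so \<open>C - {s}\<close> keeps more than half of \<open>V\<close> and contains
  a large connected part.\<close>

lemma shrink_unsplittable:
  assumes "closed_off Q C" "card V < 2 * card C" "s \<in> C" "Q \<subseteq> V"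
    and few: "(16 * k + 2) * card (insert s Q) < card V"
  shows "\<exists>U\<subseteq>C - {s}. closed_off (insert s Q) U \<and> unsplittable U \<and> card V < 2 * card U"
proof (rule large_unsplittable_part[OF _ _ _ few])
  have C: "C \<subseteq> V" "C \<inter> Q = {}" using assms by (auto simp: closed_off_def)
  have fin: "finite C" "finite Q"
    using C \<open>Q \<subseteq> V\<close> finite_V by (auto intro: finite_subset)
  show "closed_off (insert s Q) (C - {s})"
    using assms(1) unfolding closed_off_def by blast
  show "insert s Q \<subseteq> V" using C assms by auto
  have "card V * card (V - C - Q) \<le> 2 * card C * card (V - C - Q)"
    using assms(2) by (intro mult_right_mono) auto
  also have "\<dots> \<le> card V * (4 * k * card Q)"
    using separator_bound[OF assms(1) \<open>Q \<subseteq> V\<close>] by (simp add: algebra_simps)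
  finally have "card (V - C - Q) \<le> 4 * k * card Q"
    using few by (metis mult_le_cancel1 gr_zeroI not_less_zero)
  moreover have "card (V - C - Q) = card V - card C - card Q"
    using C fin \<open>Q \<subseteq> V\<close>
    by (subst card_Diff_subset, simp, blast) (simp add: card_Diff_subset)
  moreover have "card (insert s Q) = Suc (card Q)" using fin C \<open>s \<in> C\<close> by (subst card_insert_disjoint) auto
  moreover have "card (C - {s}) = card C - 1" using \<open>s \<in> C\<close> by simp
  ultimately show "card V < 2 * card (C - {s})" using few by (simp add: algebra_simps)
qed

section \<open>Committing values uphill\<close>

text \<open>A neighbour in \<open>C\<close> counts as higher because its value is still free and can
  be raised.\<close>

definition uphill :: "'a set set \<Rightarrow> ('a set \<Rightarrow> nat) \<Rightarrow> bool" where
  "uphill C g \<longleftrightarrow> (\<forall>x\<in>V - C. \<exists>y\<in>V. x \<inter> y = {} \<and> (y \<in> C \<or> g x < g y))"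

text \<open>Vertices of \<open>C - D\<close> are committed one at a time, each adjacent to what
  remains free. Connectedness of \<open>C\<close> supplies the order, found backwards by growing
  \<open>D\<close> to \<open>C\<close>.\<close>

lemma uphill_shrink:
  assumes "uphill C g" "unsplittable C" "C \<subseteq> V" "D \<subseteq> C" "D \<noteq> {}"
  shows "\<exists>g'. (\<forall>x. x \<notin> C \<longrightarrow> g' x = g x) \<and> uphill D g'"
  using \<open>D \<subseteq> C\<close> \<open>D \<noteq> {}\<close>
proof (induction "card (C - D)" arbitrary: D)
  case 0
  have "finite C" using \<open>C \<subseteq> V\<close> finite_V finite_subset by blast
  then show ?case using 0 \<open>uphill C g\<close> by (metis Diff_eq_empty_iff card_0_eq finite_Diff subset_antisym)
next
  case (Suc n)
  then have "D \<noteq> C" by auto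
  then have "\<exists>y\<in>D. \<exists>x\<in>C - D. y \<inter> x = {}"
    using \<open>unsplittable C\<close> Suc.prems by (simp add: unsplittable_def)
  then obtain y x where xy: "y \<in> D" "x \<in> C - D" "y \<inter> x = {}" by blast
  have "C - insert x D = (C - D) - {x}" by auto
  then have "n = card (C - insert x D)" using Suc.hyps(2) xy by simp
  then obtain g' where g': "\<forall>x. x \<notin> C \<longrightarrow> g' x = g x" "uphill (insert x D) g'"
    using Suc.hyps(1)[of "insert x D"] Suc.prems xy by auto
  \<comment> \<open>A new maximum puts \<open>x\<close> above every vertex that relied on
    \<open>x\<close> being free; \<open>x\<close> itself relies on \<open>y\<close>.\<close>
  let ?m = "Suc (Max (g' ` V))"
  have big: "g' z < ?m" if "z \<in> V" for z
    using that finite_V by (simp add: less_Suc_eq_le)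
  have "uphill D (g'(x := ?m))"
    unfolding uphill_def
  proof
    fix z assume z: "z \<in> V - D"
    show "\<exists>y\<in>V. z \<inter> y = {} \<and> (y \<in> D \<or> (g'(x := ?m)) z < (g'(x := ?m)) y)"
    proof (cases "z = x")
      case True
      then show ?thesis using xy Suc.prems \<open>C \<subseteq> V\<close> by blast
    next
      case False
      then obtain u where u: "u \<in> V" "z \<inter> u = {}" "u \<in> insert x D \<or> g' z < g' u"
        using g'(2) z unfolding uphill_def by blast
      then show ?thesis using False big z by (cases "u = x") auto
    qed
  qed
  then show ?case using g'(1) xy by (intro exI[of _ "g'(x := ?m)"]) auto
qed

section \<open>The submodular valuations\<close>

text \<open>On the \<open>k\<close>-sets the values lie in \<open>[2k - 1, 2k)\<close>; this is the freedom that submodularity leaves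
  when the marginals are 2 below and 0 above the middle layer.\<close>
definition val :: "('a set \<Rightarrow> nat) \<Rightarrow> 'a set \<Rightarrow> real" where
  "val g S = (if card S < k then 2 * real (card S)
     else if card S = k then 2 * real k - 1 / (real (g S) + 1) else 2 * real k)"

text \<open>The map from \<open>n\<close> to \<open>- 1 / (n + 1)\<close> is strictly increasing, so
  arbitrarily large potentials fit below \<open>2 * k\<close> with their order kept.\<close>

lemma val_le_iff:
  assumes "card S = k" "card T = k"
  shows "val g S \<le> val g T \<longleftrightarrow> g S \<le> g T"
  using assms by (simp add: val_def field_simps)

lemma val_bounds:
  "card S < k \<Longrightarrow> val g S = 2 * real (card S)"
  "card S = k \<Longrightarrow> 2 * real k - 1 \<le> val g S \<and> val g S < 2 * real k"
  "k < card S \<Longrightarrow> val g S = 2 * real k"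
  by (auto simp: val_def field_simps)

lemma val_mono:
  assumes "S \<subseteq> T" "T \<subseteq> M"
  shows "val g S \<le> val g T"
proof (cases "card S = card T")
  case True
  then show ?thesis using assms finite_M by (metis card_subset_eq finite_subset order_refl)
next
  case False
  then have "card S < card T"
    using assms finite_M by (metis card_mono finite_subset le_neq_implies_less)
  then consider "card T < k" | "card S < k" "card T = k" | "card S < k" "card T > k"
    | "card S = k" "card T > k" | "card S > k" "card T > k" by linarith
  then show ?thesis
    using \<open>card S < card T\<close> val_bounds[of S g] val_bounds[of T g] by cases force+
qed

text \<open>A marginal is \<open>2\<close> below the middle layer, in \<open>[1, 2)\<close> on
  reaching size \<open>k\<close>, in \<open>(0, 1]\<close> on leaving it, then \<open>0\<close>.
  These ranges descend, and equal sizes force \<open>S = T\<close>, so different sets of one size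
  are never compared.\<close>

lemma val_submodular:
  assumes "S \<subseteq> T" "T \<subseteq> M" "x \<in> M" "x \<notin> T"
  shows "val g (insert x S) - val g S \<ge> val g (insert x T) - val g T"
proof (cases "card S = card T")
  case True
  then show ?thesis using assms finite_M by (metis card_subset_eq finite_subset order_refl)
next
  case False
  have fin: "finite S" "finite T" using assms finite_M finite_subset by (meson subset_trans)+
  then have less: "card S < card T" using False assms by (metis card_mono le_neq_implies_less)
  have ins: "card (insert x S) = Suc (card S)" "card (insert x T) = Suc (card T)"
    using assms fin by (auto intro: card_insert_disjoint)
  have S0: "val g (insert x S) - val g S \<ge> 0"
    using val_mono[of S "insert x S" g] assms by auto
  have S1: "val g (insert x S) - val g S \<ge> 1" if "Suc (card S) = k"
    using val_bounds(1)[of S g] val_bounds(2)[of "insert x S" g] ins that by simp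
  have S2: "val g (insert x S) - val g S = 2" if "Suc (card S) < k"
    using val_bounds(1)[of S g] val_bounds(1)[of "insert x S" g] ins that by simp
  consider "Suc (card T) < k" | "Suc (card T) = k" | "card T = k" | "card T > k" by linarith
  then show ?thesis
  proof cases
    case 1
    then show ?thesis
      using S2 less ins val_bounds(1)[of T g] val_bounds(1)[of "insert x T" g] by simp
  next
    case 2
    then show ?thesis
      using S2 less ins val_bounds(1)[of T g] val_bounds(2)[of "insert x T" g] by simp
  next
    case 3
    then have "Suc (card S) = k \<or> Suc (card S) < k" using less by linarith
    then show ?thesis
      using 3 S1 S2 ins val_bounds(2)[of T g] val_bounds(3)[of "insert x T" g] by auto
  next
    case 4
    then show ?thesis
      using S0 ins val_bounds(3)[of T g] val_bounds(3)[of "insert x T" g] by simp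
  qed
qed

end

section \<open>EFX allocations as local maxima\<close>

locale odd_graph_goods = odd_graph M k for M :: "nat set" and k +
  assumes k_pos: "k \<ge> 1"
begin

lemma valuation_on_val: "valuation_on M (val g)"
proof -
  have "val g {} = 0" using k_pos by (simp add: val_def)
  then show ?thesis
    unfolding valuation_on_def using val_mono[of "{}" _ g] val_mono by auto
qed

lemma submodular_on_val: "submodular_on M (val g)"
  unfolding submodular_on_def using val_submodular by blast

text \<open>If \<open>X\<close> has fewer than \<open>k\<close> goods, \<open>Y\<close> keeps more
  than \<open>k\<close> after losing one and is worth \<open>2 * k\<close>, out of reach of
  \<open>X\<close>. If it has exactly \<open>k\<close>, the sets \<open>Y - {b}\<close> are
  precisely the neighbours of \<open>X\<close>.\<close>

lemma EFX_local_max: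
  assumes "X \<union> Y = M" "X \<inter> Y = {}"
    and XY: "\<And>b. b \<in> Y \<Longrightarrow> val g (Y - {b}) \<le> val g X"
  shows "k \<le> card X" and "\<lbrakk>card X = k; y \<in> V; X \<inter> y = {}\<rbrakk> \<Longrightarrow> g y \<le> g X"
proof -
  have fin: "finite X" "finite Y" using finite_M assms(1) by (metis finite_Un)+
  then have sum: "card X + card Y = 2 * k + 1"
    using card_M assms by (metis card_Un_disjoint)
  show "k \<le> card X"
  proof (rule ccontr)
    assume less: "\<not> k \<le> card X"
    then have "card Y > Suc k" using sum by linarith
    then obtain b where "b \<in> Y" by fastforce
    then have "card (Y - {b}) > k" using \<open>card Y > Suc k\<close> by simp
    then show False using XY[OF \<open>b \<in> Y\<close>] val_bounds(1)[of X g] val_bounds(3)[of "Y - {b}" g] less by simp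
  qed
  assume "card X = k" "y \<in> V" "X \<inter> y = {}"
  then have "y \<subseteq> Y" "card y = k" using assms(1) by (auto simp: V_def)
  moreover have "finite y" using \<open>y \<subseteq> Y\<close> fin finite_subset by blast
  ultimately have "card (Y - y) = 1" using sum \<open>card X = k\<close> by (simp add: card_Diff_subset)
  then obtain b where "Y - y = {b}" using card_1_singletonE by blast
  then have "b \<in> Y" "Y - {b} = y" using \<open>y \<subseteq> Y\<close> by auto
  then show "g y \<le> g X" using XY val_le_iff \<open>card X = k\<close> \<open>card y = k\<close> by metis
qed

text \<open>Both parts have at least \<open>k\<close> of the \<open>2 * k + 1\<close> goods, so
  exactly one has \<open>k\<close>; that one is the local maximum.\<close>

lemma EFX_has_local_max:
  assumes "allocation 2 M A" "EFX_id 2 (val g) A"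
  defines "X \<equiv> if card (A ! 0) = k then A ! 0 else A ! 1"
  shows "X \<in> V \<and> (\<forall>y\<in>V. X \<inter> y = {} \<longrightarrow> g y \<le> g X)"
proof -
  have part: "A ! 0 \<union> A ! 1 = M" "A ! 0 \<inter> A ! 1 = {}"
    using assms(1) by (auto simp: allocation_def lessThan_Suc numeral_2_eq_2)
  have "val g (A ! 1 - {b}) \<le> val g (A ! 0)" if "b \<in> A ! 1" for b
    using assms(2) that by (auto simp: EFX_id_def)
  note 0 = EFX_local_max[OF part this]
  have "val g (A ! 0 - {b}) \<le> val g (A ! 1)" if "b \<in> A ! 0" for b
    using assms(2) that by (auto simp: EFX_id_def)
  note 1 = EFX_local_max[OF part[unfolded Un_commute[of "A ! 0"] Int_commute[of "A ! 0"]] this]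
  have "card (A ! 0) + card (A ! 1) = 2 * k + 1"
    using part card_M finite_M by (metis card_Un_disjoint finite_Un)
  then have "card (A ! 0) = k \<or> card (A ! 1) = k" using 0(1) 1(1) by linarith
  then show ?thesis using 0(2) 1(2) part(1) by (auto simp: V_def X_def)
qed

section \<open>The adversary argument\<close>

text \<open>Adversary invariant: \<open>Q\<close> holds the queried sets that forced \<open>C\<close> to shrink (other queries have
  committed answers), the values of \<open>g\<close> outside \<open>C\<close> are committed, those inside are still free.\<close>
lemma adversary:
  assumes few: "(16 * k + 2) * d < card V"
    and "closed_off Q C" "unsplittable C" "card V < 2 * card C" "uphill C g"
    and "Q \<subseteq> V" "card Q \<le> d"
  shows "\<exists>g'. (\<forall>x. x \<notin> C \<longrightarrow> g' x = g x) \<and>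
    (d < num_queries M (val g') t + card Q \<or>
     \<not> (allocation 2 M (alg_output M (val g') t) \<and>
        EFX_id 2 (val g') (alg_output M (val g') t)))"
  using assms(2-)
proof (induction t arbitrary: C Q g)
  case (Leaf A)
  have "C \<subseteq> V" using Leaf by (simp add: closed_off_def)
  define X where "X = (if card (A ! 0) = k then A ! 0 else A ! 1)"
  \<comment> \<open>Positive \<open>k\<close> gives \<open>V\<close> at least two vertices, so more
    than half of them is at least two and \<open>C\<close> has a vertex other than
    \<open>X\<close>.\<close>
  obtain j where "k = Suc j" using k_pos by (cases k) auto
  then have "card V = (2 * k choose j) + (2 * k choose k)"
    unfolding card_V Suc_eq_plus1[symmetric] by (simp only: binomial_Suc_Suc)
  moreover have "0 < (2 * k choose j)" "0 < (2 * k choose k)" using \<open>k = Suc j\<close> by auto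
  ultimately have "card C > card {X}" using Leaf(3) by (simp del: zero_less_binomial_iff)
  then have "\<not> C \<subseteq> {X}" by (metis card_mono finite.emptyI finite.insertI not_less)
  \<comment> \<open>Committing all of \<open>C\<close> except \<open>z\<close> makes every ascent
    end at \<open>z\<close>; raising \<open>z\<close> above everything then leaves \<open>X\<close>
    with a higher neighbour.\<close>
  then obtain z where z: "z \<in> C" "z \<noteq> X" by blast
  then obtain g' where g': "\<forall>x. x \<notin> C \<longrightarrow> g' x = g x" "uphill {z} g'"
    using uphill_shrink[OF Leaf(4,2) \<open>C \<subseteq> V\<close>, of "{z}"] by auto
  let ?h = "g'(z := Suc (Max (g' ` V)))"
  have "\<exists>y\<in>V. X \<inter> y = {} \<and> ?h X < ?h y" if "X \<in> V"
  proof -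
    have "\<exists>y\<in>V. X \<inter> y = {} \<and> (y \<in> {z} \<or> g' X < g' y)"
      using g'(2) that z(2) by (simp add: uphill_def)
    then obtain y where y: "y \<in> V" "X \<inter> y = {}" "y = z \<or> g' X < g' y" by auto
    moreover have "g' X < Suc (Max (g' ` V))" using that finite_V by (simp add: less_Suc_eq_le)
    ultimately have "?h X < ?h y" using z(2) by auto
    then show ?thesis using y by blast
  qed
  moreover have "X \<in> V \<and> (\<forall>y\<in>V. X \<inter> y = {} \<longrightarrow> ?h y \<le> ?h X)"
    if "allocation 2 M A" "EFX_id 2 (val ?h) A"
    unfolding X_def by (rule EFX_has_local_max[OF that])
  ultimately have "\<not> (allocation 2 M A \<and> EFX_id 2 (val ?h) A)"
    by (meson leD)
  moreover have "\<forall>x. x \<notin> C \<longrightarrow> ?h x = g x" using g'(1) z(1) by auto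
  ultimately show ?case by (intro exI[of _ ?h]) (simp del: fun_upd_apply)
next
  case (Query S f)
  let ?S = "S \<inter> M"
  have C: "C \<subseteq> V" "C \<inter> Q = {}" using Query.prems by (auto simp: closed_off_def)
  show ?case
  proof (cases "?S \<in> C")
    case False
    \<comment> \<open>The answer is already fixed, since \<open>g\<close> is committed outside
      \<open>C\<close>; \<open>Q\<close> stays as it is.\<close>
    have same: "val g' ?S = val g ?S" if "\<forall>x. x \<notin> C \<longrightarrow> g' x = g x" for g'
      using that False by (simp add: val_def)
    obtain g' where g': "\<forall>x. x \<notin> C \<longrightarrow> g' x = g x"
      "d < num_queries M (val g') (f (val g ?S)) + card Q \<or>
     \<not> (allocation 2 M (alg_output M (val g') (f (val g ?S))) \<and>
        EFX_id 2 (val g') (alg_output M (val g') (f (val g ?S))))"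
      using Query.IH[OF rangeI Query.prems] by blast
    then show ?thesis using same[OF g'(1)] by (intro exI[of _ g']) auto
  next
    case True
    have "finite Q" using Query.prems finite_V finite_subset by blast
    then have card_Q: "card (insert ?S Q) = Suc (card Q)"
      using True C by (subst card_insert_disjoint) auto
    show ?thesis
    proof (cases "card Q = d")
      case True
      \<comment> \<open>The current query comes on top of the \<open>d\<close> recorded in
        \<open>Q\<close>, so the count exceeds \<open>d\<close> whatever follows.\<close>
      then show ?thesis by (intro exI[of _ g]) simp
    next
      case False
      then have le_d: "card (insert ?S Q) \<le> d" using card_Q Query.prems by simp
      then have "(16 * k + 2) * card (insert ?S Q) < card V"
        using few by (meson le_less_trans mult_le_mono2)
      \<comment> \<open>Play continues in a large connected \<open>U\<close>; the rest of
        \<open>C\<close>, the queried set included, is committed uphill before the answer is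
        given.\<close>
      from shrink_unsplittable[OF Query.prems(1,3) True Query.prems(5) this]
      obtain U where U: "U \<subseteq> C - {?S}" "closed_off (insert ?S Q) U" "unsplittable U"
        "card V < 2 * card U"
        by blast
      then have "U \<noteq> {}" by auto
      then obtain g1 where g1: "\<forall>x. x \<notin> C \<longrightarrow> g1 x = g x" "uphill U g1"
        using uphill_shrink[OF Query.prems(4,2) C(1), of U] U(1) by blast
      have "insert ?S Q \<subseteq> V" using C True Query.prems by auto
      then obtain g' where g': "\<forall>x. x \<notin> U \<longrightarrow> g' x = g1 x"
        "d < num_queries M (val g') (f (val g1 ?S)) + card (insert ?S Q) \<or>
       \<not> (allocation 2 M (alg_output M (val g') (f (val g1 ?S))) \<and>
          EFX_id 2 (val g') (alg_output M (val g') (f (val g1 ?S))))"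
        using Query.IH[OF rangeI U(2-4) g1(2) _ le_d] by blast
      have "val g' ?S = val g1 ?S" using g'(1) U(1) by (auto simp: val_def)
      moreover have "\<forall>x. x \<notin> C \<longrightarrow> g' x = g x" using g'(1) g1(1) U(1) by auto
      ultimately show ?thesis using g'(2) card_Q by (intro exI[of _ g']) auto
    qed
  qed
qed

lemma query_lower_bound:
  assumes "\<And>v. \<lbrakk>valuation_on M v; submodular_on M v\<rbrakk> \<Longrightarrow>
      allocation 2 M (alg_output M v t) \<and> EFX_id 2 v (alg_output M v t) \<and> num_queries M v t \<le> d"
  shows "(2 * k + 1) choose k \<le> (16 * k + 2) * d"
proof (rule ccontr)
  assume "\<not> ?thesis"
  then have few: "(16 * k + 2) * d < card V" by (simp only: card_V not_le)
  have "closed_off {} V" by (simp add: closed_off_def)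
  then obtain C where C: "closed_off {} C" "unsplittable C" "card V < 2 * card C"
    using large_unsplittable_part[of "{}" V] few by auto
  have "C \<subseteq> V" using C(1) by (simp add: closed_off_def)
  \<comment> \<open>An empty separator makes the bound \<open>0\<close>, so \<open>C\<close> is all
    of \<open>V\<close>: the odd graph is connected, and at the start nothing is committed.\<close>
  have "card (V - C) = 0" using separator_bound[OF C(1)] C(3) by auto
  then have "V = C" using \<open>C \<subseteq> V\<close> finite_V by auto
  then have "uphill C (\<lambda>_. 0)" by (simp add: uphill_def)
  then obtain g' where "d < num_queries M (val g') t \<or>
     \<not> (allocation 2 M (alg_output M (val g') t) \<and>
        EFX_id 2 (val g') (alg_output M (val g') t))"
    using adversary[OF few C] by force
  then show False
    using assms[OF valuation_on_val submodular_on_val, of g'] by simp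
qed

end

section \<open>The asymptotic bound\<close>

theorem theorem3p6:
  shows "\<exists>c>0. \<exists>K. \<forall>k\<ge>K. \<forall>d::nat. D_sub_EFX_id 2 (2*k+1) \<le> enat d \<longrightarrow>
           c * (1 / real k) * real ((2*k+1) choose k) \<le> real d"
proof (intro exI[of _ "1 / 18 :: real"] exI[of _ "1 :: nat"] conjI allI impI)
  fix k d :: nat
  assume "1 \<le> k" and D: "D_sub_EFX_id 2 (2 * k + 1) \<le> enat d"
  \<comment> \<open>A strict inequality on the infimum yields an actual tree; over
    \<open>enat\<close>, at most \<open>d\<close> means below \<open>Suc d\<close>.\<close>
  have "D_sub_EFX_id 2 (2 * k + 1) < enat (Suc d)"
    using D by (rule le_less_trans) simp
  then obtain t where t: "solves_EFX_id_sub 2 (2 * k + 1) t"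
    "(SUP v\<in>sub_valuations (2 * k + 1). enat (num_queries (goods (2 * k + 1)) v t)) < enat (Suc d)"
    unfolding D_sub_EFX_id_def INF_less_iff by blast
  have "num_queries (goods (2 * k + 1)) v t \<le> d" if "v \<in> sub_valuations (2 * k + 1)" for v
    using le_less_trans[OF SUP_upper[OF that] t(2)] by simp
  moreover have "odd_graph_goods (goods (2 * k + 1)) k"
    using \<open>1 \<le> k\<close> by unfold_locales (auto simp: goods_def)
  ultimately have "(2 * k + 1) choose k \<le> (16 * k + 2) * d"
    using t(1) by (intro odd_graph_goods.query_lower_bound)
      (auto simp: solves_EFX_id_sub_def sub_valuations_def)
  \<comment> \<open>For positive \<open>k\<close>, \<open>16 * k + 2\<close> is at most
    \<open>18 * k\<close>; this is the source of \<open>1 / 18\<close>.\<close>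
  also have "\<dots> \<le> 18 * k * d" using \<open>1 \<le> k\<close> by (intro mult_right_mono) auto
  finally have "real ((2 * k + 1) choose k) \<le> 18 * real k * real d"
    by (metis of_nat_le_iff of_nat_mult of_nat_numeral)
  then show "1 / 18 * (1 / real k) * real ((2 * k + 1) choose k) \<le> real d"
    using \<open>1 \<le> k\<close> by (simp add: field_simps)
qed simp

end
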